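(* Let $G$ be an undirected graph with $n$ vertices and adjacency matrix $A$, and let $m_1,m_2,m_3>0$ be integers with $m_1+m_2+m_3=n$. Then the SDP relaxation $\mathrm{MC}_{\mathrm{QAP}}$ dominates the SDP relaxation $\mathrm{MC}_{\mathrm{COP}}$; that is, the optimal value of $\mathrm{MC}_{\mathrm{QAP}}$ is greater than or equal to the optimal value of $\mathrm{MC}_{\mathrm{COP}}$.
   Context: Notation: $\mathcal{S}^+_k$ is the set of $k\times k$ real symmetric positive semidefinite matrices; $I_k$, $J_k$, $u_k$ are the identity matrix, the all-ones matrix and the all-ones vector of order $k$; $e_i$ is the $i$-th standard basis vector and $E_{ij}=e_ie_j^{\mathrm T}$ (of the size dictated by the context); $\otimes$ is the Kronecker product; $\delta_{ij}$ is the Kronecker delta; $Y\ge 0$ means that $Y$ is entrywise nonnegative. Let $B$ be the $n\times n$ adjacency matrix of the cut graph $G_{m_1,m_2,m_3}$: $$B=\begin{pmatrix} 0_{m_1\times m_1} & J_{m_1\times m_2} & 0_{m_1\times m_3}\\ J_{m_2\times m_1} & 0_{m_2\times m_2} & 0_{m_2\times m_3}\\ 0_{m_3\times m_1} & 0_{m_3\times m_2} & 0_{m_3\times m_3}\end{pmatrix},$$ where $J_{p\times q}$ is the $p\times q$ all-ones matrix. $\mathrm{MC}_{\mathrm{QAP}}$ is the semidefinite program: minimize $\frac12\operatorname{tr}\big((B\otimes A)Y\big)$ over $Y\in\mathcal{S}^+_{n^2}$ with $Y\ge 0$ subject to - $\operatorname{tr}\big((I_n\otimes E_{jj})Y\big)=1$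 and $\operatorname{tr}\big((E_{jj}\otimes I_n)Y\big)=1$ for $j=1,\dots,n$ (here $E_{jj}\in\mathbb{R}^{n\times n}$); - $\operatorname{tr}\big((I_n\otimes(J_n-I_n)+(J_n-I_n)\otimes I_n)Y\big)=0$; - $\operatorname{tr}(J_{n^2}Y)=n^2$. $\mathrm{MC}_{\mathrm{COP}}$ is the semidefinite program: minimize $\frac12\operatorname{tr}\big((D\otimes A)Y\big)$ over $Y\in\mathcal{S}^+_{3n}$ with $Y\ge0$ subject to - $\frac12\operatorname{tr}\big(((E_{ij}+E_{ji})\otimes I_n)Y\big)=m_i\delta_{ij}$ for $1\le i\le j\le 3$ (here $E_{ij}\in\mathbb{R}^{3\times3}$); - $\operatorname{tr}\big((J_3\otimes E_{ii})Y\big)=1$ for $1\le i\le n$ (here $E_{ii}\in\mathbb{R}^{n\times n}$); - $\operatorname{tr}\big((V_i^{\mathrm T}\otimes W_j)Y\big)=m_i$ for $1\le i\le 3$, $1\le j\le n$; - $\frac12\operatorname{tr}\big(((E_{ij}+E_{ji})\otimes J_n)Y\big)=m_im_j$ for $1\le i\le j\le3$ (here $E_{ij}\in\mathbb{R}^{3\times3}$); where $D=E_{12}+E_{21}\in\mathbb{R}^{3\times3}$, $V_i=e_iu_3^{\mathrm T}\in\mathbb{R}^{3\times3}$ and $W_j=e_ju_n^{\mathrm T}\in\mathbb{R}^{n\times n}$. *)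

theory Defs
  imports
    "HOL-Library.Extended_Real"
    "Jordan_Normal_Form.Matrix"
    "Graph_Theory.Pair_Digraph"
begin

(* Matrix rows and columns, the parts of the partition and the entries of the list
   [m1, m2, m3] are all indexed from 0. *)

definition ones_mat :: "nat \<Rightarrow> nat \<Rightarrow> real mat" where
  "ones_mat p q = mat p q (\<lambda>_. 1)"

definition ones_vec :: "nat \<Rightarrow> real vec" where
  "ones_vec k = vec k (\<lambda>_. 1)"

definition outer_prod :: "real vec \<Rightarrow> real vec \<Rightarrow> real mat" where
  "outer_prod u v = mat (dim_vec u) (dim_vec v) (\<lambda>(i, j). u $ i * v $ j)"

definition unit_mat :: "nat \<Rightarrow> nat \<Rightarrow> nat \<Rightarrow> real mat" where
  "unit_mat k i j = outer_prod (unit_vec k i) (unit_vec k j)"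

definition kron :: "real mat \<Rightarrow> real mat \<Rightarrow> real mat" (infixl \<open>\<otimes>\<^sub>K\<close> 75) where
  "A \<otimes>\<^sub>K B = mat (dim_row A * dim_row B) (dim_col A * dim_col B)
     (\<lambda>(i, j). A $$ (i div dim_row B, j div dim_col B) * B $$ (i mod dim_row B, j mod dim_col B))"

definition tr :: "real mat \<Rightarrow> real" where
  "tr A = (\<Sum>i<dim_row A. A $$ (i, i))"

definition psd_mats :: "nat \<Rightarrow> real mat set" where
  "psd_mats k = {Y \<in> carrier_mat k k. transpose_mat Y = Y \<and>
     (\<forall>x \<in> carrier_vec k. x \<bullet> (Y *\<^sub>v x) \<ge> 0)}"

definition nonneg_mat :: "real mat \<Rightarrow> bool" where
  "nonneg_mat Y \<longleftrightarrow> (\<forall>i < dim_row Y. \<forall>j < dim_col Y. Y $$ (i, j) \<ge> 0)"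

(* Adjacency matrix with respect to the vertex ordering vs. *)
definition adjacency_mat :: "'v pair_pre_digraph \<Rightarrow> 'v list \<Rightarrow> real mat" where
  "adjacency_mat G vs = mat (length vs) (length vs)
     (\<lambda>(i, j). if (vs ! i, vs ! j) \<in> parcs G then 1 else 0)"

definition cut_graph_mat :: "nat \<Rightarrow> nat \<Rightarrow> nat \<Rightarrow> real mat" where
  "cut_graph_mat m1 m2 m3 =
     four_block_mat
       (four_block_mat (0\<^sub>m m1 m1) (ones_mat m1 m2) (ones_mat m2 m1) (0\<^sub>m m2 m2))
       (0\<^sub>m (m1 + m2) m3)
       (0\<^sub>m m3 (m1 + m2))
       (0\<^sub>m m3 m3)"

(* Optimal value of the minimization problem; it is \<infinity> if there is no feasible point. *)
definition min_value :: "'a set \<Rightarrow> ('a \<Rightarrow> real) \<Rightarrow> ereal" where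
  "min_value F f = (INF Y\<in>F. ereal (f Y))"

definition MC_QAP_feasible :: "nat \<Rightarrow> real mat set" where
  "MC_QAP_feasible n = {Y \<in> psd_mats (n\<^sup>2). nonneg_mat Y \<and>
     (\<forall>j < n. tr ((1\<^sub>m n \<otimes>\<^sub>K unit_mat n j j) * Y) = 1 \<and>
              tr ((unit_mat n j j \<otimes>\<^sub>K 1\<^sub>m n) * Y) = 1) \<and>
     tr ((1\<^sub>m n \<otimes>\<^sub>K (ones_mat n n - 1\<^sub>m n) + (ones_mat n n - 1\<^sub>m n) \<otimes>\<^sub>K 1\<^sub>m n) * Y) = 0 \<and>
     tr (ones_mat (n\<^sup>2) (n\<^sup>2) * Y) = (real n)\<^sup>2}"

definition MC_QAP :: "nat \<Rightarrow> real mat \<Rightarrow> nat \<Rightarrow> nat \<Rightarrow> nat \<Rightarrow> ereal" where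
  "MC_QAP n A m1 m2 m3 =
     min_value (MC_QAP_feasible n) (\<lambda>Y. 1 / 2 * tr ((cut_graph_mat m1 m2 m3 \<otimes>\<^sub>K A) * Y))"

definition MC_COP_feasible :: "nat \<Rightarrow> nat \<Rightarrow> nat \<Rightarrow> nat \<Rightarrow> real mat set" where
  "MC_COP_feasible n m1 m2 m3 =
     (let m = (\<lambda>i. real ([m1, m2, m3] ! i));
          V = (\<lambda>i. outer_prod (unit_vec 3 i) (ones_vec 3));
          W = (\<lambda>j. outer_prod (unit_vec n j) (ones_vec n))
      in {Y \<in> psd_mats (3 * n). nonneg_mat Y \<and>
           (\<forall>j < 3. \<forall>i \<le> j.
              1 / 2 * tr (((unit_mat 3 i j + unit_mat 3 j i) \<otimes>\<^sub>K 1\<^sub>m n) * Y) =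
                (if i = j then m i else 0)) \<and>
           (\<forall>i < n. tr ((ones_mat 3 3 \<otimes>\<^sub>K unit_mat n i i) * Y) = 1) \<and>
           (\<forall>i < 3. \<forall>j < n. tr ((transpose_mat (V i) \<otimes>\<^sub>K W j) * Y) = m i) \<and>
           (\<forall>j < 3. \<forall>i \<le> j.
              1 / 2 * tr (((unit_mat 3 i j + unit_mat 3 j i) \<otimes>\<^sub>K ones_mat n n) * Y) =
                m i * m j)})"

definition MC_COP :: "nat \<Rightarrow> real mat \<Rightarrow> nat \<Rightarrow> nat \<Rightarrow> nat \<Rightarrow> ereal" where
  "MC_COP n A m1 m2 m3 =
     min_value (MC_COP_feasible n m1 m2 m3)
       (\<lambda>Y. 1 / 2 * tr (((unit_mat 3 0 1 + unit_mat 3 1 0) \<otimes>\<^sub>K A) * Y))"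

end

theory Submission
  imports Defs
begin

text \<open>
  Index the rows and columns of a matrix \<open>Y\<close> feasible for the quadratic-assignment relaxation by
  pairs: \<open>y p a q b\<close> below is the entry \<open>(a, b)\<close> of the \<open>n \<times> n\<close> block \<open>(p, q)\<close>. In a genuine
  assignment \<open>y p a q b = 1\<close> says that vertex \<open>a\<close> is sent to slot \<open>p\<close> and vertex \<open>b\<close> to slot \<open>q\<close>,
  where the slots are the vertices of the cut graph. Forgetting which slot of its part a vertex is
  sent to turns an assignment into a partition. On matrices this adds up the blocks \<open>(p, q)\<close> with
  \<open>p\<close> in part \<open>i\<close> and \<open>q\<close> in part \<open>j\<close> (\<open>lump\<close>). The result \<open>Z\<close> is feasible for the partition
  relaxation and has the same objective value, so the infimum over the partition relaxation is at
  most the other one.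

  Lumping pulls test vectors back from the parts to the slots, so it preserves positive
  semidefiniteness (\<open>lump_psd\<close>). It is also adjoint to pulling back coefficients: the trace of
  \<open>(M \<otimes> N) Z\<close> is the trace of \<open>(M' \<otimes> N) Y\<close> with \<open>M' p q = M (g p) (g q)\<close>, where \<open>g\<close> sends a slot to
  its part (\<open>tr_kron_lump\<close>). The cut graph matrix is the pullback of
  \<open>unit_mat 3 0 1 + unit_mat 3 1 0\<close>, hence the objectives agree, and each constraint on \<open>Z\<close> becomes a statement about block sums of \<open>Y\<close>.

  Two of these statements are not among the constraints on \<open>Y\<close>: all entries of each single block
  add up to 1, and so do the entries that share their row's vertex and their column's slot. They
  follow from positive semidefiniteness (\<open>MC_QAP_feasible_block_sums\<close>). Let \<open>d p\<close> be the indicator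
  vector of the indices in slot \<open>p\<close>. The zero pattern and the diagonal constraints give every \<open>d p\<close>
  unit length for the form of \<open>Y\<close>, while the sum of all \<open>n\<^sup>2\<close> inner products of the \<open>d p\<close> is
  \<open>n\<^sup>2\<close>. Inner products of unit vectors are at most 1, so all of them equal 1 and the vectors \<open>d p\<close>
  coincide modulo the kernel of \<open>Y\<close> (\<open>bilin_eq_of_unit_gram\<close>). The same holds for the indicator
  vectors of the vertices.
\<close>

section \<open>Positive semidefinite bilinear forms\<close>

text \<open>Vectors are represented by functions, of which only the values below \<open>k\<close> matter. Indicator
  vectors and finite linear combinations then need no dimension side conditions.\<close>

definition bilin :: "nat \<Rightarrow> real mat \<Rightarrow> (nat \<Rightarrow> real) \<Rightarrow> (nat \<Rightarrow> real) \<Rightarrow> real" where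
  "bilin k Y x z = (\<Sum>i<k. \<Sum>j<k. x i * Y $$ (i, j) * z j)"

lemma scalar_prod_mult_mat_vec_eq_bilin:
  assumes "Y \<in> carrier_mat k k" "x \<in> carrier_vec k"
  shows "x \<bullet> (Y *\<^sub>v x) = bilin k Y (\<lambda>i. x $ i) (\<lambda>i. x $ i)"
  using assms
  by (auto simp: bilin_def scalar_prod_def sum_distrib_left mult.assoc atLeast0LessThan
      intro!: sum.cong)

lemma psd_mats_iff_bilin:
  "Y \<in> psd_mats k \<longleftrightarrow> Y \<in> carrier_mat k k \<and>
     (\<forall>i<k. \<forall>j<k. Y $$ (i, j) = Y $$ (j, i)) \<and> (\<forall>x. bilin k Y x x \<ge> 0)"
proof -
  have sym: "transpose_mat Y = Y \<longleftrightarrow> (\<forall>i<k. \<forall>j<k. Y $$ (i, j) = Y $$ (j, i))"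
    if Y: "Y \<in> carrier_mat k k"
    using Y by (auto simp: mat_eq_iff)
  have psd: "(\<forall>x\<in>carrier_vec k. x \<bullet> (Y *\<^sub>v x) \<ge> 0) \<longleftrightarrow> (\<forall>x. bilin k Y x x \<ge> 0)"
    if Y: "Y \<in> carrier_mat k k"
  proof (intro iffI allI ballI)
    fix x assume *: "\<forall>x\<in>carrier_vec k. x \<bullet> (Y *\<^sub>v x) \<ge> 0"
    have "bilin k Y x x = bilin k Y (\<lambda>i. vec k x $ i) (\<lambda>i. vec k x $ i)"
      by (simp add: bilin_def)
    also have "\<dots> = vec k x \<bullet> (Y *\<^sub>v vec k x)"
      by (rule scalar_prod_mult_mat_vec_eq_bilin[symmetric]) (use Y in auto)
    also have "\<dots> \<ge> 0"
      using * vec_carrier by blast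
    finally show "bilin k Y x x \<ge> 0" .
  qed (simp add: scalar_prod_mult_mat_vec_eq_bilin[OF Y])
  show ?thesis
    using sym psd unfolding psd_mats_def by blast
qed

lemma bilin_commute:
  assumes "Y \<in> psd_mats k"
  shows "bilin k Y x z = bilin k Y z x"
proof -
  have "bilin k Y x z = (\<Sum>j<k. \<Sum>i<k. x i * Y $$ (i, j) * z j)"
    unfolding bilin_def by (rule sum.swap)
  also have "\<dots> = bilin k Y z x"
    unfolding bilin_def
    by (intro sum.cong refl) (use assms in \<open>auto simp: psd_mats_iff_bilin\<close>)
  finally show ?thesis .
qed

lemma bilin_add_left: "bilin k Y (\<lambda>i. x i + x' i) z = bilin k Y x z + bilin k Y x' z"
  by (simp add: bilin_def sum.distrib algebra_simps)

lemma bilin_scale_left: "bilin k Y (\<lambda>i. c * x i) z = c * bilin k Y x z"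
  by (simp add: bilin_def sum_distrib_left mult.assoc)

lemma bilin_diff_left: "bilin k Y (\<lambda>i. x i - x' i) z = bilin k Y x z - bilin k Y x' z"
  by (simp add: bilin_def sum_subtractf algebra_simps)

lemma bilin_sum_left: "bilin k Y (\<lambda>i. \<Sum>p\<in>P. x p i) z = (\<Sum>p\<in>P. bilin k Y (x p) z)"
proof -
  have "bilin k Y (\<lambda>i. \<Sum>p\<in>P. x p i) z = (\<Sum>i<k. \<Sum>p\<in>P. \<Sum>j<k. x p i * Y $$ (i, j) * z j)"
    unfolding bilin_def sum_distrib_right by (intro sum.cong refl sum.swap)
  also have "\<dots> = (\<Sum>p\<in>P. bilin k Y (x p) z)"
    unfolding bilin_def by (rule sum.swap)
  finally show ?thesis .
qed

lemma bilin_sum_right: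
  assumes "Y \<in> psd_mats k"
  shows "bilin k Y x (\<lambda>i. \<Sum>p\<in>P. z p i) = (\<Sum>p\<in>P. bilin k Y x (z p))"
  by (simp add: bilin_commute[OF assms, of x] bilin_sum_left)

text \<open>The quadratic form at \<open>z + t x\<close> is affine in \<open>t\<close> when \<open>x\<close> has length 0. It is nonnegative for
  all \<open>t\<close> only if its slope vanishes.\<close>

lemma bilin_isotropic_eq_0:
  assumes Y: "Y \<in> psd_mats k" and x: "bilin k Y x x = 0"
  shows "bilin k Y x z = 0"
proof (rule ccontr)
  let ?c = "bilin k Y x z" and ?q = "bilin k Y z z"
  assume c: "?c \<noteq> 0"
  have "bilin k Y (\<lambda>i. z i + t * x i) (\<lambda>i. z i + t * x i) = ?q + 2 * t * ?c" for t
    using x bilin_commute[OF Y, of z "\<lambda>i. z i + t * x i"]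
      bilin_commute[OF Y, of x "\<lambda>i. z i + t * x i"] bilin_commute[OF Y, of z x]
    by (simp add: bilin_add_left bilin_scale_left)
  then have nonneg: "?q + 2 * t * ?c \<ge> 0" for t
    using Y unfolding psd_mats_iff_bilin by metis
  \<comment> \<open>This value of \<open>t\<close> makes the quadratic form equal to \<open>-1\<close>.\<close>
  have "2 * (- (?q + 1) / (2 * ?c)) * ?c = - (?q + 1)"
    using c by simp
  with nonneg[of "- (?q + 1) / (2 * ?c)"] show False by linarith
qed

text \<open>The squared distance of two unit vectors is 2 minus twice their inner product. If the inner
  products have average 1, these nonnegative distances add up to 0, so each of them vanishes.\<close>

lemma bilin_eq_of_unit_gram:
  assumes Y: "Y \<in> psd_mats k" and P: "finite P"
    and unit: "\<And>p. p \<in> P \<Longrightarrow> bilin k Y (d p) (d p) = 1"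
    and total: "(\<Sum>p\<in>P. \<Sum>q\<in>P. bilin k Y (d p) (d q)) = (real (card P))\<^sup>2"
    and pq: "p \<in> P" "q \<in> P"
  shows "bilin k Y (d p) z = bilin k Y (d q) z"
proof -
  let ?w = "\<lambda>p q i. d p i - d q i"
  have w: "bilin k Y (?w p q) (?w p q) = 2 - 2 * bilin k Y (d p) (d q)"
    if "p \<in> P" "q \<in> P" for p q
    using unit[OF that(1)] unit[OF that(2)] bilin_commute[OF Y, of "d p" "?w p q"]
      bilin_commute[OF Y, of "d q" "?w p q"] bilin_commute[OF Y, of "d p" "d q"]
    by (simp add: bilin_diff_left)
  have nonneg: "bilin k Y x x \<ge> 0" for x
    using Y by (simp add: psd_mats_iff_bilin)
  have "(\<Sum>p\<in>P. \<Sum>q\<in>P. bilin k Y (?w p q) (?w p q)) =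
        (\<Sum>p\<in>P. \<Sum>q\<in>P. 2 - 2 * bilin k Y (d p) (d q))"
    using w by simp
  also have "\<dots> = 0"
    using total
    by (simp add: sum_subtractf sum_distrib_left[symmetric] power2_eq_square)
  finally have "(\<Sum>(p, q)\<in>P \<times> P. bilin k Y (?w p q) (?w p q)) = 0"
    by (simp add: sum.cartesian_product)
  then have "\<forall>(p, q)\<in>P \<times> P. bilin k Y (?w p q) (?w p q) = 0"
    using P nonneg by (subst (asm) sum_nonneg_eq_0_iff) (auto split: prod.splits)
  then have "bilin k Y (?w p q) (?w p q) = 0"
    using pq by blast
  from bilin_isotropic_eq_0[OF Y this, of z] show ?thesis
    by (simp add: bilin_diff_left)
qed

section \<open>Block indices, Kronecker products and traces\<close>

lemma block_index_less:
  assumes "p < m" "a < n"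
  shows "p * n + a < m * (n::nat)"
proof -
  have "p * n + a < Suc p * n" using assms by simp
  also have "\<dots> \<le> m * n" using assms by (intro mult_le_mono1) simp
  finally show ?thesis .
qed

lemma sum_block:
  fixes f :: "nat \<Rightarrow> 'a :: comm_monoid_add"
  shows "(\<Sum>i<m * n. f i) = (\<Sum>p<m. \<Sum>a<n. f (p * n + a))"
proof -
  have "(\<Sum>i<m * n. f i) = (\<Sum>p<m. sum f {p * n..<p * n + n})"
    by (rule sum.nat_group[symmetric])
  also have "\<dots> = (\<Sum>p<m. \<Sum>a<n. f (p * n + a))"
  proof (rule sum.cong)
    fix p
    show "sum f {p * n..<p * n + n} = (\<Sum>a<n. f (p * n + a))"
      using sum.shift_bounds_nat_ivl[of f 0 "p * n" n]
      by (simp add: add.commute atLeast0LessThan)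
  qed simp
  finally show ?thesis .
qed

lemma bilin_block:
  "bilin (m * n) Y x z = (\<Sum>p<m. \<Sum>a<n. \<Sum>q<m. \<Sum>b<n.
     x (p * n + a) * Y $$ (p * n + a, q * n + b) * z (q * n + b))"
  by (simp add: bilin_def sum_block)

lemma kron_carrier:
  "M \<in> carrier_mat m m \<Longrightarrow> N \<in> carrier_mat n n \<Longrightarrow> M \<otimes>\<^sub>K N \<in> carrier_mat (m * n) (m * n)"
  by (simp add: kron_def)

lemma kron_index:
  assumes "M \<in> carrier_mat m m" "N \<in> carrier_mat n n" "p < m" "q < m" "a < n" "b < n"
  shows "(M \<otimes>\<^sub>K N) $$ (p * n + a, q * n + b) = M $$ (p, q) * N $$ (a, b)"
  using assms by (simp add: kron_def block_index_less)

lemma tr_mult_eq_sum: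
  assumes "M \<in> carrier_mat k k" "Y \<in> carrier_mat k k"
    and "\<And>i j. i < k \<Longrightarrow> j < k \<Longrightarrow> Y $$ (i, j) = Y $$ (j, i)"
  shows "tr (M * Y) = (\<Sum>i<k. \<Sum>j<k. M $$ (i, j) * Y $$ (i, j))"
  using assms by (simp add: tr_def scalar_prod_def atLeast0LessThan)

text \<open>The Frobenius product of \<open>M\<close> with \<open>c\<close>. The second argument is a function so that the pairing
  can be nested, once over blocks and once inside each block.\<close>

definition pairing :: "nat \<Rightarrow> real mat \<Rightarrow> (nat \<Rightarrow> nat \<Rightarrow> real) \<Rightarrow> real" where
  "pairing k M c = (\<Sum>p<k. \<Sum>q<k. M $$ (p, q) * c p q)"

lemma pairing_one_mat: "pairing k (1\<^sub>m k) c = (\<Sum>p<k. c p p)"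
  unfolding pairing_def by (intro sum.cong refl) (simp add: if_distrib[of "\<lambda>x. x * _"] cong: if_cong)

lemma pairing_ones_mat: "pairing k (ones_mat k k) c = (\<Sum>p<k. \<Sum>q<k. c p q)"
  by (simp add: pairing_def ones_mat_def)

lemma unit_mat_carrier: "unit_mat k i j \<in> carrier_mat k k"
  by (simp add: unit_mat_def outer_prod_def)

lemma unit_mat_index:
  assumes "p < k" "q < k"
  shows "unit_mat k i j $$ (p, q) = of_bool (p = i) * of_bool (q = j)"
  using assms by (simp add: unit_mat_def outer_prod_def unit_vec_def)

lemma pairing_unit_mat:
  assumes "i < k" "j < k"
  shows "pairing k (unit_mat k i j) c = c i j"
proof -
  have "pairing k (unit_mat k i j) c =
      (\<Sum>p<k. of_bool (p = i) * (\<Sum>q<k. of_bool (q = j) * c p q))"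
    unfolding pairing_def sum_distrib_left
    by (intro sum.cong refl) (simp add: unit_mat_index)
  also have "\<dots> = c i j"
    using assms by (simp add: of_bool_def if_distrib[of "\<lambda>x. x * _"] cong: if_cong)
  finally show ?thesis .
qed

text \<open>For symmetric \<open>Y\<close> the trace is the Frobenius product, and for a Kronecker product it splits:
  \<open>N\<close> acts inside each block, and \<open>M\<close> on the resulting matrix of block values.\<close>

lemma tr_kron_mult:
  assumes M: "M \<in> carrier_mat m m" and N: "N \<in> carrier_mat n n"
    and Y: "Y \<in> psd_mats (m * n)"
  shows "tr ((M \<otimes>\<^sub>K N) * Y) =
    pairing m M (\<lambda>p q. pairing n N (\<lambda>a b. Y $$ (p * n + a, q * n + b)))"
proof -
  have "tr ((M \<otimes>\<^sub>K N) * Y) =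
      (\<Sum>i<m * n. \<Sum>j<m * n. (M \<otimes>\<^sub>K N) $$ (i, j) * Y $$ (i, j))"
    by (rule tr_mult_eq_sum) (use Y kron_carrier[OF M N] in \<open>auto simp: psd_mats_iff_bilin\<close>)
  also have "\<dots> = (\<Sum>p<m. \<Sum>a<n. \<Sum>q<m. \<Sum>b<n.
           M $$ (p, q) * N $$ (a, b) * Y $$ (p * n + a, q * n + b))"
    unfolding sum_block by (intro sum.cong refl) (simp add: kron_index[OF M N])
  also have "\<dots> = (\<Sum>p<m. \<Sum>q<m. \<Sum>a<n. \<Sum>b<n.
           M $$ (p, q) * N $$ (a, b) * Y $$ (p * n + a, q * n + b))"
    by (intro sum.cong refl sum.swap)
  finally show ?thesis
    by (simp add: pairing_def sum_distrib_left mult.assoc)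
qed

section \<open>Adding up blocks\<close>

text \<open>In matrix terms this is \<open>P\<^sup>T Y P\<close>, where \<open>P\<close> is the Kronecker product of the 0-1 incidence
  matrix of \<open>g\<close> with the identity. The entrywise form avoids computing with that product.\<close>

definition lump :: "nat \<Rightarrow> nat \<Rightarrow> nat \<Rightarrow> (nat \<Rightarrow> nat) \<Rightarrow> real mat \<Rightarrow> real mat" where
  "lump m k n g Y = mat (m * n) (m * n) (\<lambda>(i, j).
     \<Sum>p | p < k \<and> g p = i div n. \<Sum>q | q < k \<and> g q = j div n.
       Y $$ (p * n + i mod n, q * n + j mod n))"

lemma lump_carrier: "lump m k n g Y \<in> carrier_mat (m * n) (m * n)"
  by (simp add: lump_def)

lemma lump_index:
  assumes "i < m" "j < m" "a < n" "b < n"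
  shows "lump m k n g Y $$ (i * n + a, j * n + b) =
     (\<Sum>p | p < k \<and> g p = i. \<Sum>q | q < k \<and> g q = j. Y $$ (p * n + a, q * n + b))"
  using assms by (simp add: lump_def block_index_less)

text \<open>Lumping is adjoint to pulling back the coefficients along \<open>g\<close>. Sums over \<open>i\<close> and then over
  the fibre of \<open>i\<close> are sums over all \<open>p\<close>.\<close>

lemma sum_lump:
  assumes g: "\<And>p. p < k \<Longrightarrow> g p < m"
  shows "(\<Sum>i<m. \<Sum>a<n. \<Sum>j<m. \<Sum>b<n. F i a j b * lump m k n g Y $$ (i * n + a, j * n + b)) =
    (\<Sum>p<k. \<Sum>a<n. \<Sum>q<k. \<Sum>b<n. F (g p) a (g q) b * Y $$ (p * n + a, q * n + b))"
proof -
  have fibres: "(\<Sum>i<m. \<Sum>p | p < k \<and> g p = i. f p) = (\<Sum>p<k. f p)" for f :: "nat \<Rightarrow> real"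
    using sum.group[of "{..<k}" "{..<m}" g f] g by (simp add: image_subset_iff)
  have inner: "(\<Sum>j<m. \<Sum>b<n. F i a j b * lump m k n g Y $$ (i * n + a, j * n + b)) =
      (\<Sum>p | p < k \<and> g p = i. \<Sum>q<k. \<Sum>b<n. F (g p) a (g q) b * Y $$ (p * n + a, q * n + b))"
    if ia: "i < m" "a < n" for i a
  proof -
    let ?f = "\<lambda>p q b. F (g p) a (g q) b * Y $$ (p * n + a, q * n + b)"
    have "(\<Sum>j<m. \<Sum>b<n. F i a j b * lump m k n g Y $$ (i * n + a, j * n + b)) =
        (\<Sum>j<m. \<Sum>b<n. \<Sum>p | p < k \<and> g p = i. \<Sum>q | q < k \<and> g q = j. ?f p q b)"
      using ia by (intro sum.cong refl) (auto simp: lump_index sum_distrib_left intro!: sum.cong)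
    also have "\<dots> = (\<Sum>j<m. \<Sum>p | p < k \<and> g p = i. \<Sum>b<n. \<Sum>q | q < k \<and> g q = j. ?f p q b)"
      by (intro sum.cong refl sum.swap)
    also have "\<dots> = (\<Sum>p | p < k \<and> g p = i. \<Sum>j<m. \<Sum>b<n. \<Sum>q | q < k \<and> g q = j. ?f p q b)"
      by (rule sum.swap)
    also have "\<dots> = (\<Sum>p | p < k \<and> g p = i. \<Sum>j<m. \<Sum>q | q < k \<and> g q = j. \<Sum>b<n. ?f p q b)"
      by (intro sum.cong refl sum.swap)
    also have "\<dots> = (\<Sum>p | p < k \<and> g p = i. \<Sum>q<k. \<Sum>b<n. ?f p q b)"
      by (simp only: fibres)
    finally show ?thesis .
  qed
  have "(\<Sum>i<m. \<Sum>a<n. \<Sum>j<m. \<Sum>b<n. F i a j b * lump m k n g Y $$ (i * n + a, j * n + b)) =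
      (\<Sum>i<m. \<Sum>a<n. \<Sum>p | p < k \<and> g p = i. \<Sum>q<k. \<Sum>b<n.
         F (g p) a (g q) b * Y $$ (p * n + a, q * n + b))"
    by (intro sum.cong refl inner) auto
  also have "\<dots> = (\<Sum>i<m. \<Sum>p | p < k \<and> g p = i. \<Sum>a<n. \<Sum>q<k. \<Sum>b<n.
         F (g p) a (g q) b * Y $$ (p * n + a, q * n + b))"
    by (intro sum.cong refl sum.swap)
  also have "\<dots> = (\<Sum>p<k. \<Sum>a<n. \<Sum>q<k. \<Sum>b<n. F (g p) a (g q) b * Y $$ (p * n + a, q * n + b))"
    by (rule fibres)
  finally show ?thesis .
qed

lemma lump_psd:
  assumes g: "\<And>p. p < k \<Longrightarrow> g p < m" and Y: "Y \<in> psd_mats (k * n)"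
  shows "lump m k n g Y \<in> psd_mats (m * n)"
proof (cases "n = 0")
  case True
  then show ?thesis by (auto simp: psd_mats_iff_bilin lump_def bilin_def)
next
  case False
  have "lump m k n g Y $$ (i, j) = lump m k n g Y $$ (j, i)" if "i < m * n" "j < m * n" for i j
  proof -
    let ?y = "\<lambda>p q. Y $$ (p * n + i mod n, q * n + j mod n)"
    let ?y' = "\<lambda>p q. Y $$ (p * n + j mod n, q * n + i mod n)"
    have "lump m k n g Y $$ (i, j) =
        (\<Sum>q | q < k \<and> g q = j div n. \<Sum>p | p < k \<and> g p = i div n. ?y p q)"
      using that by (simp add: lump_def) (rule sum.swap)
    also have "\<dots> = (\<Sum>q | q < k \<and> g q = j div n. \<Sum>p | p < k \<and> g p = i div n. ?y' q p)"
      using Y False by (intro sum.cong refl) (auto simp: psd_mats_iff_bilin block_index_less)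
    also have "\<dots> = lump m k n g Y $$ (j, i)"
      using that by (simp add: lump_def)
    finally show ?thesis .
  qed
  moreover have "bilin (m * n) (lump m k n g Y) x x \<ge> 0" for x
  proof -
    \<comment> \<open>The pullback of \<open>x\<close> along \<open>g\<close>, constant on each fibre.\<close>
    let ?x = "\<lambda>i. x (g (i div n) * n + i mod n)"
    have "bilin (m * n) (lump m k n g Y) x x =
        (\<Sum>i<m. \<Sum>a<n. \<Sum>j<m. \<Sum>b<n. x (i * n + a) * x (j * n + b) *
           lump m k n g Y $$ (i * n + a, j * n + b))"
      by (simp add: bilin_block ac_simps)
    also have "\<dots> = (\<Sum>p<k. \<Sum>a<n. \<Sum>q<k. \<Sum>b<n. x (g p * n + a) * x (g q * n + b) *
           Y $$ (p * n + a, q * n + b))"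
      by (rule sum_lump[OF g])
    also have "\<dots> = bilin (k * n) Y ?x ?x"
      by (simp add: bilin_block ac_simps)
    also have "\<dots> \<ge> 0"
      using Y by (simp add: psd_mats_iff_bilin)
    finally show ?thesis .
  qed
  ultimately show ?thesis by (simp add: psd_mats_iff_bilin lump_carrier)
qed

lemma lump_nonneg:
  assumes Y: "Y \<in> carrier_mat (k * n) (k * n)" "nonneg_mat Y"
  shows "nonneg_mat (lump m k n g Y)"
proof -
  have "lump m k n g Y $$ (i, j) \<ge> 0" if ij: "i < m * n" "j < m * n" for i j
  proof -
    have "n > 0" using ij by (cases "n = 0") auto
    then have "Y $$ (p * n + i mod n, q * n + j mod n) \<ge> 0" if "p < k" "q < k" for p q
      using Y that by (auto simp: nonneg_mat_def block_index_less)
    then show ?thesis using ij by (auto simp: lump_def intro!: sum_nonneg)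
  qed
  then show ?thesis
    using lump_carrier[of m k n g Y] by (auto simp: nonneg_mat_def)
qed

text \<open>This translates every linear constraint and the objective of the partition relaxation to the
  original matrix.\<close>

lemma tr_kron_lump:
  assumes g: "\<And>p. p < k \<Longrightarrow> g p < m" and Y: "Y \<in> psd_mats (k * n)"
    and M: "M \<in> carrier_mat m m" and N: "N \<in> carrier_mat n n"
  shows "tr ((M \<otimes>\<^sub>K N) * lump m k n g Y) =
    (\<Sum>p<k. \<Sum>q<k. M $$ (g p, g q) * pairing n N (\<lambda>a b. Y $$ (p * n + a, q * n + b)))"
proof -
  have "tr ((M \<otimes>\<^sub>K N) * lump m k n g Y) = (\<Sum>p<m. \<Sum>q<m. \<Sum>a<n. \<Sum>b<n.
      M $$ (p, q) * N $$ (a, b) * lump m k n g Y $$ (p * n + a, q * n + b))"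
    by (simp add: tr_kron_mult[OF M N lump_psd[OF g Y]] pairing_def sum_distrib_left mult.assoc)
  also have "\<dots> = (\<Sum>p<m. \<Sum>a<n. \<Sum>q<m. \<Sum>b<n.
      M $$ (p, q) * N $$ (a, b) * lump m k n g Y $$ (p * n + a, q * n + b))"
    by (intro sum.cong refl sum.swap)
  also have "\<dots> = (\<Sum>p<k. \<Sum>a<n. \<Sum>q<k. \<Sum>b<n.
      M $$ (g p, g q) * N $$ (a, b) * Y $$ (p * n + a, q * n + b))"
    by (rule sum_lump[OF g])
  also have "\<dots> = (\<Sum>p<k. \<Sum>q<k. \<Sum>a<n. \<Sum>b<n.
      M $$ (g p, g q) * N $$ (a, b) * Y $$ (p * n + a, q * n + b))"
    by (intro sum.cong refl sum.swap)
  finally show ?thesis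
    by (simp add: pairing_def sum_distrib_left mult.assoc)
qed

section \<open>Feasible points of the quadratic-assignment relaxation\<close>

lemma bilin_indicator:
  assumes "i < k" "j < k"
  shows "bilin k Y (\<lambda>i'. of_bool (i' = i)) (\<lambda>j'. of_bool (j' = j)) = Y $$ (i, j)"
proof -
  have "bilin k Y (\<lambda>i'. of_bool (i' = i)) (\<lambda>j'. of_bool (j' = j)) =
      pairing k (unit_mat k i j) (\<lambda>i' j'. Y $$ (i', j'))"
    by (simp add: bilin_def pairing_def unit_mat_index ac_simps)
  then show ?thesis using assms by (simp add: pairing_unit_mat)
qed

text \<open>Used to read block sums of \<open>Y\<close> as values of its bilinear form.\<close>

lemma bilin_sum_indicator:
  assumes Y: "Y \<in> psd_mats k" and "\<And>a. a \<in> S \<Longrightarrow> f a < k" "\<And>b. b \<in> T \<Longrightarrow> h b < k"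
  shows "bilin k Y (\<lambda>i. \<Sum>a\<in>S. of_bool (i = f a)) (\<lambda>i. \<Sum>b\<in>T. of_bool (i = h b)) =
    (\<Sum>a\<in>S. \<Sum>b\<in>T. Y $$ (f a, h b))"
  using assms by (simp add: bilin_sum_left bilin_sum_right[OF Y] bilin_indicator)

lemma MC_QAP_feasible_psd: "Y \<in> MC_QAP_feasible n \<Longrightarrow> Y \<in> psd_mats (n * n)"
  by (simp add: MC_QAP_feasible_def power2_eq_square)

text \<open>The single equation with right-hand side 0 pairs two entrywise nonnegative matrices, so it
  forces a zero wherever its coefficient is positive: no vertex goes to two slots and no slot
  receives two vertices.\<close>

lemma MC_QAP_feasible_zero:
  assumes Y: "Y \<in> MC_QAP_feasible n" and idx: "p < n" "a < n" "q < n" "b < n"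
    and pat: "(p = q) \<noteq> (a = b)"
  shows "Y $$ (p * n + a, q * n + b) = 0"
proof -
  let ?N = "n * n"
  let ?M = "1\<^sub>m n \<otimes>\<^sub>K (ones_mat n n - 1\<^sub>m n) + (ones_mat n n - 1\<^sub>m n) \<otimes>\<^sub>K 1\<^sub>m n"
  have J: "ones_mat n n - 1\<^sub>m n \<in> carrier_mat n n" by (auto simp: ones_mat_def)
  have I: "1\<^sub>m n \<in> carrier_mat n n" by simp
  note cs = kron_carrier[OF I J] kron_carrier[OF J I]
  have M: "?M \<in> carrier_mat ?N ?N" using cs by auto
  note psd = MC_QAP_feasible_psd[OF Y]
  have entry: "?M $$ (p * n + a, q * n + b) =
      of_bool (p = q) * of_bool (a \<noteq> b) + of_bool (p \<noteq> q) * of_bool (a = b)"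
    if "p < n" "a < n" "q < n" "b < n" for p a q b
    using that cs kron_index[OF I J] kron_index[OF J I]
    by (auto simp: block_index_less ones_mat_def)
  have nn: "?M $$ (i, j) * Y $$ (i, j) \<ge> 0" if "i < ?N" "j < ?N" for i j
  proof -
    have n: "n > 0" using that by (cases "n = 0") auto
    have "?M $$ (i, j) \<ge> 0"
      using entry[of "i div n" "i mod n" "j div n" "j mod n"] n that
      by (simp add: less_mult_imp_div_less)
    moreover have "Y $$ (i, j) \<ge> 0"
      using Y psd that by (auto simp: MC_QAP_feasible_def nonneg_mat_def psd_mats_iff_bilin)
    ultimately show ?thesis by simp
  qed
  have "(\<Sum>i<?N. \<Sum>j<?N. ?M $$ (i, j) * Y $$ (i, j)) = tr (?M * Y)"
    by (rule tr_mult_eq_sum[symmetric]) (use M psd in \<open>auto simp: psd_mats_iff_bilin\<close>)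
  also have "\<dots> = 0" using Y by (simp add: MC_QAP_feasible_def)
  finally have "(\<Sum>(i, j)\<in>{..<?N} \<times> {..<?N}. ?M $$ (i, j) * Y $$ (i, j)) = 0"
    by (simp add: sum.cartesian_product)
  then have "\<forall>(i, j)\<in>{..<?N} \<times> {..<?N}. ?M $$ (i, j) * Y $$ (i, j) = 0"
    using nn by (subst (asm) sum_nonneg_eq_0_iff) (auto split: prod.splits)
  then have "?M $$ (p * n + a, q * n + b) * Y $$ (p * n + a, q * n + b) = 0"
    using idx by (simp add: block_index_less)
  then show ?thesis using idx pat by (auto simp: entry)
qed

lemma MC_QAP_feasible_diagonal:
  assumes Y: "Y \<in> MC_QAP_feasible n" and "j < n"
  shows "(\<Sum>p<n. Y $$ (p * n + j, p * n + j)) = 1"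
    and "(\<Sum>a<n. Y $$ (j * n + a, j * n + a)) = 1"
proof -
  have tr1: "tr ((1\<^sub>m n \<otimes>\<^sub>K unit_mat n j j) * Y) = 1" "tr ((unit_mat n j j \<otimes>\<^sub>K 1\<^sub>m n) * Y) = 1"
    using assms by (auto simp: MC_QAP_feasible_def)
  note tr = tr_kron_mult[OF _ _ MC_QAP_feasible_psd[OF Y]]
  show "(\<Sum>p<n. Y $$ (p * n + j, p * n + j)) = 1"
    using tr1(1) \<open>j < n\<close> by (simp add: tr unit_mat_carrier pairing_one_mat pairing_unit_mat)
  show "(\<Sum>a<n. Y $$ (j * n + a, j * n + a)) = 1"
    using tr1(2) \<open>j < n\<close> by (simp add: tr unit_mat_carrier pairing_one_mat pairing_unit_mat)
qed

lemma MC_QAP_feasible_total: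
  assumes Y: "Y \<in> MC_QAP_feasible n"
  shows "(\<Sum>p<n. \<Sum>q<n. \<Sum>a<n. \<Sum>b<n. Y $$ (p * n + a, q * n + b)) = (real n)\<^sup>2"
proof -
  note psd = MC_QAP_feasible_psd[OF Y]
  have "(real n)\<^sup>2 = tr (ones_mat (n * n) (n * n) * Y)"
    using Y by (simp add: MC_QAP_feasible_def power2_eq_square)
  also have "\<dots> = (\<Sum>i<n * n. \<Sum>j<n * n. ones_mat (n * n) (n * n) $$ (i, j) * Y $$ (i, j))"
    by (rule tr_mult_eq_sum) (use psd in \<open>auto simp: psd_mats_iff_bilin ones_mat_def\<close>)
  also have "\<dots> = (\<Sum>i<n * n. \<Sum>j<n * n. Y $$ (i, j))"
    by (simp add: ones_mat_def)
  also have "\<dots> = (\<Sum>p<n. \<Sum>a<n. \<Sum>q<n. \<Sum>b<n. Y $$ (p * n + a, q * n + b))"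
    unfolding sum_block ..
  also have "\<dots> = (\<Sum>p<n. \<Sum>q<n. \<Sum>a<n. \<Sum>b<n. Y $$ (p * n + a, q * n + b))"
    by (intro sum.cong refl sum.swap)
  finally show ?thesis by simp
qed

text \<open>Both families of indicator vectors, \<open>d p\<close> of slot \<open>p\<close> and \<open>f a\<close> of vertex \<open>a\<close>, satisfy the
  hypotheses of \<open>bilin_eq_of_unit_gram\<close>. They have the same sum, the all-ones vector, so the
  constraint on the sum of all entries gives the total for both. Hence the
  inner products of \<open>d p\<close> with \<open>d q\<close> are all 1. The inner product of \<open>f a\<close> with \<open>d q\<close> depends on
  neither \<open>a\<close> nor \<open>q\<close>; averaging over \<open>a\<close> replaces the sum of the \<open>f a\<close> by the sum of the \<open>d p\<close>
  and shows that it is 1 as well.\<close>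

lemma MC_QAP_feasible_block_sums:
  assumes Y: "Y \<in> MC_QAP_feasible n"
  shows "p < n \<Longrightarrow> q < n \<Longrightarrow> (\<Sum>a<n. \<Sum>b<n. Y $$ (p * n + a, q * n + b)) = 1"
    and "a < n \<Longrightarrow> q < n \<Longrightarrow> (\<Sum>p<n. \<Sum>b<n. Y $$ (p * n + a, q * n + b)) = 1"
proof -
  note psd = MC_QAP_feasible_psd[OF Y]
  define d where "d p i = (\<Sum>a<n. of_bool (i = p * n + a) :: real)" for p i
  define f where "f a i = (\<Sum>p<n. of_bool (i = p * n + a) :: real)" for a i
  let ?B = "bilin (n * n) Y"
  have dd: "?B (d p) (d q) = (\<Sum>a<n. \<Sum>b<n. Y $$ (p * n + a, q * n + b))" if "p < n" "q < n" for p q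
    unfolding d_def by (rule bilin_sum_indicator[OF psd]) (use that in \<open>auto simp: block_index_less\<close>)
  have ff: "?B (f a) (f b) = (\<Sum>p<n. \<Sum>q<n. Y $$ (p * n + a, q * n + b))" if "a < n" "b < n" for a b
    unfolding f_def by (rule bilin_sum_indicator[OF psd]) (use that in \<open>auto simp: block_index_less\<close>)
  have fd: "?B (f a) (d q) = (\<Sum>p<n. \<Sum>b<n. Y $$ (p * n + a, q * n + b))" if "a < n" "q < n" for a q
    unfolding f_def d_def
    by (rule bilin_sum_indicator[OF psd]) (use that in \<open>auto simp: block_index_less\<close>)
  have dd1: "?B (d p) (d p) = 1" if "p < n" for p
  proof -
    have "(\<Sum>b<n. Y $$ (p * n + a, p * n + b)) = Y $$ (p * n + a, p * n + a)" if "a < n" for a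
    proof -
      have "(\<Sum>b<n. Y $$ (p * n + a, p * n + b)) =
          (\<Sum>b<n. if b = a then Y $$ (p * n + a, p * n + b) else 0)"
        using \<open>p < n\<close> that by (intro sum.cong refl) (auto simp: MC_QAP_feasible_zero[OF Y])
      with that show ?thesis by simp
    qed
    with that show ?thesis by (simp add: dd MC_QAP_feasible_diagonal[OF Y])
  qed
  have ff1: "?B (f a) (f a) = 1" if "a < n" for a
  proof -
    have "(\<Sum>q<n. Y $$ (p * n + a, q * n + a)) = Y $$ (p * n + a, p * n + a)" if "p < n" for p
    proof -
      have "(\<Sum>q<n. Y $$ (p * n + a, q * n + a)) =
          (\<Sum>q<n. if q = p then Y $$ (p * n + a, q * n + a) else 0)"
        using \<open>a < n\<close> that by (intro sum.cong refl) (auto simp: MC_QAP_feasible_zero[OF Y])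
      with that show ?thesis by simp
    qed
    with that show ?thesis by (simp add: ff MC_QAP_feasible_diagonal[OF Y])
  qed
  have d_total: "(\<Sum>p<n. \<Sum>q<n. ?B (d p) (d q)) = (real (card {..<n}))\<^sup>2"
    using MC_QAP_feasible_total[OF Y] by (simp add: dd)
  have f_total: "(\<Sum>a<n. \<Sum>b<n. ?B (f a) (f b)) = (real (card {..<n}))\<^sup>2"
  proof -
    have sum_f: "(\<lambda>i. \<Sum>a<n. f a i) = (\<lambda>i. \<Sum>p<n. d p i)"
      unfolding f_def d_def by (intro ext sum.swap)
    have "(\<Sum>a<n. \<Sum>b<n. ?B (f a) (f b)) = ?B (\<lambda>i. \<Sum>a<n. f a i) (\<lambda>i. \<Sum>a<n. f a i)"
      by (simp add: bilin_sum_left bilin_sum_right[OF psd])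
    also have "\<dots> = (\<Sum>p<n. \<Sum>q<n. ?B (d p) (d q))"
      unfolding sum_f by (simp add: bilin_sum_left bilin_sum_right[OF psd])
    finally show ?thesis using d_total by simp
  qed
  have d_eq: "?B (d p) z = ?B (d q) z" if "p < n" "q < n" for p q z
    by (rule bilin_eq_of_unit_gram[OF psd _ _ d_total]) (use dd1 that in auto)
  have f_eq: "?B (f a) z = ?B (f b) z" if "a < n" "b < n" for a b z
    by (rule bilin_eq_of_unit_gram[OF psd _ _ f_total]) (use ff1 that in auto)
  show "(\<Sum>a<n. \<Sum>b<n. Y $$ (p * n + a, q * n + b)) = 1" if "p < n" "q < n"
    using dd[OF that] d_eq[OF that, of "d q"] dd1[OF that(2)] by simp
  show "(\<Sum>p<n. \<Sum>b<n. Y $$ (p * n + a, q * n + b)) = 1" if "a < n" "q < n"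
  proof -
    have "real n * ?B (f a) (d q) = (\<Sum>b<n. ?B (f b) (d q))"
      using f_eq[OF _ that(1), of _ "d q"] by simp
    also have "\<dots> = (\<Sum>p<n. ?B (d p) (d q))"
      unfolding bilin_sum_left[symmetric] f_def d_def by (subst sum.swap) (rule refl)
    also have "\<dots> = real n"
      using d_eq[OF _ that(2), of _ "d q"] dd1[OF that(2)] by simp
    finally show ?thesis using that by (simp add: fd)
  qed
qed

section \<open>Lumping along the parts of the cut graph\<close>

definition part_of :: "nat \<Rightarrow> nat \<Rightarrow> nat \<Rightarrow> nat" where
  "part_of m1 m2 p = (if p < m1 then 0 else if p < m1 + m2 then 1 else 2)"

lemma part_of_less: "part_of m1 m2 p < 3"
  by (simp add: part_of_def)

lemma part_of_size:
  assumes "i < 3"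
  shows "(\<Sum>p<m1 + m2 + m3. of_bool (part_of m1 m2 p = i)) = real ([m1, m2, m3] ! i)"
proof -
  have "(\<Sum>p<m1 + m2 + m3. of_bool (part_of m1 m2 p = i)) =
      real (card {p \<in> {..<m1 + m2 + m3}. part_of m1 m2 p = i})"
    by (simp add: of_bool_def flip: sum.inter_filter)
  also have "{p \<in> {..<m1 + m2 + m3}. part_of m1 m2 p = i} =
      [{..<m1}, {m1..<m1 + m2}, {m1 + m2..<m1 + m2 + m3}] ! i"
    using assms by (auto simp: part_of_def less_Suc_eq numeral_3_eq_3 split: if_splits)
  also have "card \<dots> = [m1, m2, m3] ! i"
    using assms by (auto simp: less_Suc_eq numeral_3_eq_3)
  finally show ?thesis .
qed

lemma cut_graph_mat_carrier:
  "cut_graph_mat m1 m2 m3 \<in> carrier_mat (m1 + m2 + m3) (m1 + m2 + m3)"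
  unfolding cut_graph_mat_def by (intro four_block_carrier_mat) (auto simp: ones_mat_def)

lemma cut_graph_mat_index:
  assumes "p < m1 + m2 + m3" "q < m1 + m2 + m3"
  shows "cut_graph_mat m1 m2 m3 $$ (p, q) =
    (unit_mat 3 0 1 + unit_mat 3 1 0) $$ (part_of m1 m2 p, part_of m1 m2 q)"
  using assms
  by (simp add: cut_graph_mat_def unit_mat_def outer_prod_def ones_mat_def part_of_def)

text \<open>For each constraint the factor acting inside the blocks is evaluated first. For the identity
  it gives the Kronecker delta of the slots, for a diagonal matrix unit a diagonal entry or 0, and
  for the all-ones matrix 1. What remains counts slots in the parts. The constraint with \<open>V\<close> and
  \<open>W\<close> mixes slots and vertices and uses the second kind of block sum.\<close>

lemma lump_MC_COP_feasible:
  assumes Y: "Y \<in> MC_QAP_feasible n" and n: "m1 + m2 + m3 = n"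
  shows "lump 3 n n (part_of m1 m2) Y \<in> MC_COP_feasible n m1 m2 m3"
proof -
  let ?g = "part_of m1 m2" and ?m = "\<lambda>i. real ([m1, m2, m3] ! i)"
  let ?Z = "lump 3 n n ?g Y"
  note psd = MC_QAP_feasible_psd[OF Y]
  note tr = tr_kron_lump[OF part_of_less[of m1 m2] psd]
  have size: "(\<Sum>p<n. of_bool (?g p = i)) = ?m i" if "i < 3" for i
    unfolding n[symmetric] by (rule part_of_size[OF that])
  have E: "unit_mat 3 i j + unit_mat 3 j i \<in> carrier_mat 3 3" for i j
    using unit_mat_carrier by simp
  have E_index: "(unit_mat 3 i j + unit_mat 3 j i) $$ (?g p, ?g q) =
      of_bool (?g p = i) * of_bool (?g q = j) + of_bool (?g p = j) * of_bool (?g q = i)" for i j p q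
    using unit_mat_carrier[of 3 j i] part_of_less[of m1 m2] by (simp add: unit_mat_index)
  have Z: "?Z \<in> psd_mats (3 * n)"
    by (rule lump_psd[OF part_of_less psd])
  have Z0: "nonneg_mat ?Z"
    by (rule lump_nonneg) (use Y psd in \<open>auto simp: MC_QAP_feasible_def psd_mats_iff_bilin\<close>)
  have c1: "1 / 2 * tr (((unit_mat 3 i j + unit_mat 3 j i) \<otimes>\<^sub>K 1\<^sub>m n) * ?Z) =
      (if i = j then ?m i else 0)" if "i < 3" "j < 3" for i j
  proof -
    have inner: "pairing n (1\<^sub>m n) (\<lambda>a b. Y $$ (p * n + a, q * n + b)) = (if q = p then 1 else 0)"
      if "p < n" "q < n" for p q
      using that by (auto simp: pairing_one_mat MC_QAP_feasible_diagonal[OF Y] MC_QAP_feasible_zero[OF Y])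
    have "tr (((unit_mat 3 i j + unit_mat 3 j i) \<otimes>\<^sub>K 1\<^sub>m n) * ?Z) =
        (\<Sum>p<n. \<Sum>q<n. if q = p then 2 * (of_bool (?g p = i) * of_bool (?g p = j)) else 0)"
      unfolding tr[OF E one_carrier_mat]
      by (intro sum.cong refl) (use inner in \<open>auto simp: E_index\<close>)
    also have "\<dots> = 2 * (\<Sum>p<n. of_bool (?g p = i) * of_bool (?g p = j))"
      unfolding sum_distrib_left by simp
    also have "(\<Sum>p<n. of_bool (?g p = i) * of_bool (?g p = j)) =
        (\<Sum>p<n. if i = j then of_bool (?g p = i) else (0 :: real))"
      by (intro sum.cong refl) auto
    also have "\<dots> = (if i = j then ?m i else 0)"
      using size[OF that(1)] by auto
    finally show ?thesis by simp
  qed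
  have c2: "tr ((ones_mat 3 3 \<otimes>\<^sub>K unit_mat n i i) * ?Z) = 1" if "i < n" for i
  proof -
    have J: "ones_mat 3 3 \<in> carrier_mat 3 3" by (simp add: ones_mat_def)
    have J_index: "ones_mat 3 3 $$ (?g p, ?g q) = 1" for p q
      using part_of_less[of m1 m2] by (simp add: ones_mat_def)
    have "tr ((ones_mat 3 3 \<otimes>\<^sub>K unit_mat n i i) * ?Z) =
        (\<Sum>p<n. \<Sum>q<n. if q = p then Y $$ (p * n + i, q * n + i) else 0)"
      unfolding tr[OF J unit_mat_carrier] using that
      by (intro sum.cong refl)
        (auto simp: J_index pairing_unit_mat MC_QAP_feasible_zero[OF Y])
    then show ?thesis using MC_QAP_feasible_diagonal(1)[OF Y that] by simp
  qed
  have c3: "tr ((transpose_mat (outer_prod (unit_vec 3 i) (ones_vec 3)) \<otimes>\<^sub>K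
      outer_prod (unit_vec n j) (ones_vec n)) * ?Z) = ?m i" (is "tr ((?V \<otimes>\<^sub>K ?W) * _) = _")
    if "i < 3" "j < n" for i j
  proof -
    have V: "?V \<in> carrier_mat 3 3" "?W \<in> carrier_mat n n"
      by (auto simp: outer_prod_def ones_vec_def)
    have V_index: "?V $$ (?g p, ?g q) = of_bool (?g q = i)" for p q
      using part_of_less[of m1 m2] by (simp add: outer_prod_def ones_vec_def unit_vec_def)
    have W: "pairing n ?W c = (\<Sum>b<n. c j b)" for c
    proof -
      have "pairing n ?W c = (\<Sum>a<n. if a = j then \<Sum>b<n. c a b else 0)"
        unfolding pairing_def
        by (intro sum.cong refl) (auto simp: outer_prod_def ones_vec_def unit_vec_def)
      then show ?thesis using that by simp
    qed
    have "tr ((?V \<otimes>\<^sub>K ?W) * ?Z) =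
        (\<Sum>p<n. \<Sum>q<n. of_bool (?g q = i) * (\<Sum>b<n. Y $$ (p * n + j, q * n + b)))"
      by (subst tr[OF V]) (simp add: V_index W)
    also have "\<dots> = (\<Sum>q<n. \<Sum>p<n. of_bool (?g q = i) * (\<Sum>b<n. Y $$ (p * n + j, q * n + b)))"
      by (rule sum.swap)
    also have "\<dots> = (\<Sum>q<n. of_bool (?g q = i) * (\<Sum>p<n. \<Sum>b<n. Y $$ (p * n + j, q * n + b)))"
      by (simp only: sum_distrib_left)
    also have "\<dots> = ?m i"
      using that size[OF that(1)] by (simp add: MC_QAP_feasible_block_sums[OF Y])
    finally show ?thesis .
  qed
  have c4: "1 / 2 * tr (((unit_mat 3 i j + unit_mat 3 j i) \<otimes>\<^sub>K ones_mat n n) * ?Z) = ?m i * ?m j"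
    if "i < 3" "j < 3" for i j
  proof -
    have J: "ones_mat n n \<in> carrier_mat n n" by (simp add: ones_mat_def)
    have "tr (((unit_mat 3 i j + unit_mat 3 j i) \<otimes>\<^sub>K ones_mat n n) * ?Z) =
        (\<Sum>p<n. \<Sum>q<n. of_bool (?g p = i) * of_bool (?g q = j) + of_bool (?g p = j) * of_bool (?g q = i))"
      by (subst tr[OF E J]) (simp add: E_index pairing_ones_mat MC_QAP_feasible_block_sums[OF Y])
    also have "\<dots> = 2 * (?m i * ?m j)"
      unfolding sum.distrib sum_product[symmetric] size[OF that(1)] size[OF that(2)] by simp
    finally show ?thesis by simp
  qed
  show ?thesis
    unfolding MC_COP_feasible_def Let_def
    using Z Z0 c1 c2 c3 c4 by auto
qed

lemma lump_objective:
  assumes Y: "Y \<in> psd_mats (n * n)" and A: "A \<in> carrier_mat n n" and n: "m1 + m2 + m3 = n"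
  shows "tr (((unit_mat 3 0 1 + unit_mat 3 1 0) \<otimes>\<^sub>K A) * lump 3 n n (part_of m1 m2) Y) =
    tr ((cut_graph_mat m1 m2 m3 \<otimes>\<^sub>K A) * Y)"
proof -
  have D: "unit_mat 3 0 1 + unit_mat 3 1 0 \<in> carrier_mat 3 3"
    using unit_mat_carrier by simp
  have B: "cut_graph_mat m1 m2 m3 \<in> carrier_mat n n"
    using cut_graph_mat_carrier n by blast
  show ?thesis
    unfolding tr_kron_lump[OF part_of_less Y D A] tr_kron_mult[OF B A Y]
      pairing_def[of n "cut_graph_mat m1 m2 m3"]
    by (intro sum.cong refl) (use n in \<open>simp add: cut_graph_mat_index\<close>)
qed

theorem theorem1:
  fixes G :: "'v pair_pre_digraph" and vs :: "'v list"
    and n m1 m2 m3 :: nat and A :: "real mat"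
  assumes "pair_graph G"
    and "distinct vs" and "set vs = pverts G" and "card (pverts G) = n"
    and "A = adjacency_mat G vs"
    and "m1 > 0" and "m2 > 0" and "m3 > 0"
    and "m1 + m2 + m3 = n"
  shows "MC_QAP n A m1 m2 m3 \<ge> MC_COP n A m1 m2 m3"
proof -
  have A: "A \<in> carrier_mat n n"
    using assms(2-5) distinct_card[of vs] by (auto simp: adjacency_mat_def)
  show ?thesis
    unfolding MC_QAP_def MC_COP_def min_value_def
  proof (rule INF_mono)
    fix Y assume Y: "Y \<in> MC_QAP_feasible n"
    show "\<exists>Z\<in>MC_COP_feasible n m1 m2 m3.
        ereal (1 / 2 * tr (((unit_mat 3 0 1 + unit_mat 3 1 0) \<otimes>\<^sub>K A) * Z))
        \<le> ereal (1 / 2 * tr ((cut_graph_mat m1 m2 m3 \<otimes>\<^sub>K A) * Y))"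
      using lump_MC_COP_feasible[OF Y assms(9)]
        lump_objective[OF MC_QAP_feasible_psd[OF Y] A assms(9)] by force
  qed
qed

end
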